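(* Let $A\in[0,1]^{n\times n}$, $0<\lambda<1$, and let $(K_1,L_1)$, $(K_2,L_2)$ be two different secure partitions of $\{1,\dots,n\}$ (with respect to $\mathcal{G}(A^{(\lambda)})$) such that $L_1\subseteq L_2$. Then: (1) there is a node $k\in L_2\setminus L_1=K_1\setminus K_2$ which is secure in $\mathcal{G}(A^{(\lambda)}_{K_1K_1})$; (2) for a node $k\in K_1$, the partition $(K_1\setminus\{k\},L_1\cup\{k\})$ is secure if and only if $k$ is secure in $\mathcal{G}(A^{(\lambda)}_{K_1K_1})$.
   Context: $A^{(\lambda)}$ has entries $a_{ij}-\lambda$; for an index set $K$, $A^{(\lambda)}_{KK}$ is its principal submatrix on $K$. For a matrix $B$, $\mathcal{G}(B)$ is the weighted digraph on its index set with all edges $(i,j)$, edge $(i,j)$ of weight $b_{ij}$; the weight of a walk is the sum of its edge weights. A node $i$ of a weighted digraph is secure if every walk starting in $i$ has nonpositive weight. A partition $(K,L)$ of $\{1,\dots,n\}$ ($K\cup L=\{1,\dots,n\}$, $K\cap L=\emptyset$) is secure (w.r.t. $\mathcal{G}(A^{(\lambda)})$) if: when $K,L$ are both nonempty, every walk in $\mathcal{G}(A^{(\lambda)})$ that starts in a node of $L$ and has all other nodes in $K$ has nonpositive weight; the partition $(\{1,\dots,n\},\emptyset)$ is secure iff $\mathcal{G}(A^{(\lambda)})$ is $\lambda$-secure, meaning every walk $P$ in it has weight $w(P)\le\lambda$; the partition $(\emptyset,\{1,\dots,n\})$ is always secure. *)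

theory Defs
  imports "HOL-Analysis.Analysis" "Graph_Theory.Weighted_Graph"
begin

definition shifted :: "real ^ 'n ^ 'n \<Rightarrow> real \<Rightarrow> real ^ 'n ^ 'n" where
  "shifted A \<mu> = (\<chi> i j. A $ i $ j - \<mu>)"

text \<open>
  The digraph of the principal submatrix of \<open>B\<close> on \<open>K\<close> is the pair of
  \<open>complete_digraph K\<close> and \<open>entry_weight B\<close>: the submatrix keeps the original indices, so that its
  index set is \<open>K\<close> and its entries are those of \<open>B\<close>. The digraph of \<open>B\<close> itself is the case
  \<open>K = UNIV\<close>.
\<close>

definition complete_digraph :: "'v set \<Rightarrow> ('v, 'v \<times> 'v) pre_digraph" where
  "complete_digraph K = \<lparr>verts = K, arcs = K \<times> K, tail = fst, head = snd\<rparr>"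

definition entry_weight :: "real ^ 'n ^ 'n \<Rightarrow> ('n \<times> 'n) weight_fun" where
  "entry_weight B = (\<lambda>(i, j). B $ i $ j)"

text \<open>
  The locale \<^locale>\<open>wf_digraph\<close> defines \<open>awalk_cost\<close> independently of the graph, which is why no
  graph argument appears below. The walk without arcs is admitted; it has weight 0 and hence
  satisfies all the bounds that are imposed (\<open>\<mu> > 0\<close> in the application).
\<close>

abbreviation walk_weight :: "'e weight_fun \<Rightarrow> 'e list \<Rightarrow> real" where
  "walk_weight w p \<equiv> wf_digraph.awalk_cost w p"

definition secure_node :: "('v, 'e) pre_digraph \<Rightarrow> 'e weight_fun \<Rightarrow> 'v \<Rightarrow> bool" where
  "secure_node G w i \<longleftrightarrow> i \<in> verts G \<and>
     (\<forall>p v. pre_digraph.awalk G i p v \<longrightarrow> walk_weight w p \<le> 0)"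

definition bounded_secure :: "('v, 'e) pre_digraph \<Rightarrow> 'e weight_fun \<Rightarrow> real \<Rightarrow> bool" where
  "bounded_secure G w \<mu> \<longleftrightarrow>
     (\<forall>u p v. pre_digraph.awalk G u p v \<longrightarrow> walk_weight w p \<le> \<mu>)"

text \<open>
  In the last case below, \<^term>\<open>tl (pre_digraph.awalk_verts G u p)\<close> lists the nodes of the walk
  other than its starting occurrence of \<open>u\<close>.
\<close>

definition secure_partition ::
  "('v, 'e) pre_digraph \<Rightarrow> 'e weight_fun \<Rightarrow> real \<Rightarrow> 'v set \<Rightarrow> 'v set \<Rightarrow> bool" where
  "secure_partition G w \<mu> K L \<longleftrightarrow> K \<union> L = verts G \<and> K \<inter> L = {} \<and>
     (if L = {} then bounded_secure G w \<mu>
      else if K = {} then True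
      else (\<forall>u\<in>L. \<forall>p v. pre_digraph.awalk G u p v \<and> set (tl (pre_digraph.awalk_verts G u p)) \<subseteq> K
              \<longrightarrow> walk_weight w p \<le> 0))"

end

theory Submission
  imports Defs
begin

text \<open>
  A positive closed walk inside \<open>K\<close> could be repeated, which would make the weights of walks inside
  \<open>K\<close> unbounded; security of \<open>(K, L)\<close> bounds them by \<open>\<mu>\<close>, because a node of \<open>L\<close> can be put in front
  at a cost of at most \<open>\<mu>\<close>. So closed walks inside \<open>K\<close> have nonpositive weight, and cutting a walk at
  its last visit to a set \<open>D\<close> leaves a walk that avoids \<open>D\<close> after its start. With \<open>D = {k}\<close> this
  gives (2). For (1), \<open>D = K\<^sub>1 - K\<^sub>2\<close>: the remaining walk has nonpositive weight by security of
  \<open>(K\<^sub>2, L\<^sub>2)\<close>, so if no node of \<open>D\<close> were secure, each would be joined to another node of \<open>D\<close> by a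
  walk of positive weight, and finiteness of \<open>D\<close> would yield a positive closed walk.
\<close>

abbreviation awalk_in :: "'v set \<Rightarrow> 'v \<Rightarrow> ('v \<times> 'v) list \<Rightarrow> 'v \<Rightarrow> bool" where
  "awalk_in K \<equiv> pre_digraph.awalk (complete_digraph K)"

text \<open>The node list of a walk is computed from the tail and head maps, which are the same for
  all \<open>K\<close>; taking \<open>UNIV\<close> fixes one representative.\<close>

abbreviation nodes :: "'v \<Rightarrow> ('v \<times> 'v) list \<Rightarrow> 'v list" where
  "nodes \<equiv> pre_digraph.awalk_verts (complete_digraph UNIV)"

lemma complete_digraph_sel [simp]:
  "verts (complete_digraph K) = K" "arcs (complete_digraph K) = K \<times> K"
  "tail (complete_digraph K) = fst" "head (complete_digraph K) = snd"
  by (simp_all add: complete_digraph_def)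

interpretation complete: wf_digraph "complete_digraph K" for K
  by unfold_locales auto

lemma awalk_verts_complete_digraph:
  "pre_digraph.awalk_verts (complete_digraph K) u p = nodes u p"
  by (induction p arbitrary: u) simp_all

text \<open>Every pair of nodes of \<open>K\<close> is an arc, so staying in the subgraph is a
  condition on visited nodes only. This lets walks pass between the digraph of a principal submatrix
  and the full digraph.\<close>

lemma awalk_in_iff: "awalk_in K u p v \<longleftrightarrow> awalk_in UNIV u p v \<and> set (nodes u p) \<subseteq> K"
proof (induction p arbitrary: u)
  case (Cons e p)
  have "head (complete_digraph UNIV) e \<in> set (nodes (snd e) p)" if "awalk_in UNIV (snd e) p v"
    using complete.hd_in_awalk_verts(1)[OF that] by simp
  then show ?case
    using Cons by (cases e) (auto simp: complete.awalk_Cons_iff)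
qed (auto simp: complete.awalk_Nil_iff)

lemma awalk_in_mono: "awalk_in K u p v \<Longrightarrow> K \<subseteq> K' \<Longrightarrow> awalk_in K' u p v"
  unfolding awalk_in_iff[of K] awalk_in_iff[of K'] by (meson order_trans)

lemma awalk_in_of_tl_nodes:
  assumes "awalk_in UNIV u p v" "set (tl (nodes u p)) \<subseteq> K" "u \<in> K"
  shows "awalk_in K u p v"
proof -
  have "nodes u p = u # tl (nodes u p)"
    using assms(1) by (metis complete.awalk_verts_non_Nil complete.awhd_of_awalk list.collapse)
  then show ?thesis
    using assms unfolding awalk_in_iff[of K] by (metis insert_subset list.simps(15))
qed

lemma awalk_in_split_last:
  assumes p: "awalk_in K u p v" and "u \<in> D"
  obtains q r d where "p = q @ r" "d \<in> D" "awalk_in K u q d" "awalk_in K d r v"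
    "set (tl (nodes d r)) \<subseteq> K - D"
proof -
  let ?vs = "pre_digraph.awalk_verts (complete_digraph K)"
  have "\<exists>x\<in>set (?vs u p). x \<in> D"
    using complete.hd_in_awalk_verts(1)[OF p] assms(2) by (rule bexI[rotated])
  then obtain xs d ys where d: "?vs u p = xs @ d # ys" "d \<in> D" "\<forall>x\<in>set ys. x \<notin> D"
    by (auto elim!: split_list_last_propE)
  from p have "pre_digraph.cas (complete_digraph K) u p v" by blast
  then obtain q r where qr: "pre_digraph.cas (complete_digraph K) u q d"
    "pre_digraph.cas (complete_digraph K) d r v" "p = q @ r" "?vs d r = d # ys"
    using d(1) by (rule complete.awalk_decomp_verts)
  have "set (?vs u p) \<subseteq> K"
    using p by (simp add: awalk_in_iff[of K] awalk_verts_complete_digraph[of K])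
  with d have "d \<in> K" "set ys \<subseteq> K" by auto
  with p qr have "awalk_in K u q d" "awalk_in K d r v"
    by (auto simp: pre_digraph.awalk_def)
  moreover have "set (tl (nodes d r)) \<subseteq> K - D"
    using qr(4) d(3) \<open>set ys \<subseteq> K\<close> by (auto simp: awalk_verts_complete_digraph[of K])
  ultimately show ?thesis using that qr(3) d(2) by blast
qed

lemma closed_awalk_replicate:
  assumes "awalk_in K k p k"
  shows "awalk_in K k (concat (replicate n p)) k"
    and "walk_weight w (concat (replicate n p)) = real n * walk_weight w p"
proof -
  show "awalk_in K k (concat (replicate n p)) k"
  proof (induction n)
    case 0
    from assms have "k \<in> K" by (auto simp: pre_digraph.awalk_def)
    then show ?case by (simp add: complete.awalk_Nil_iff)
  next
    case (Suc n)
    then show ?case using complete.awalk_appendI[OF assms Suc] by simp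
  qed
  show "walk_weight w (concat (replicate n p)) = real n * walk_weight w p"
    by (induction n) (simp_all add: algebra_simps)
qed

lemma closed_awalk_nonpos:
  assumes "awalk_in K k p k" and "\<And>q. awalk_in K k q k \<Longrightarrow> walk_weight w q \<le> c"
  shows "walk_weight w p \<le> 0"
proof (rule ccontr)
  assume "\<not> walk_weight w p \<le> 0"
  then obtain n where "c < real n * walk_weight w p"
    using reals_Archimedean3 by (metis not_le)
  then show False
    using assms closed_awalk_replicate[OF assms(1)] by (metis not_le)
qed

text \<open>Removes the case distinction of the definition: \<open>L\<close> contains
  \<open>u\<close>, and if \<open>K\<close> is empty, then \<open>p\<close> has no arc, since the
  head of an arc would be a later node.\<close>

lemma secure_partition_leave_nonpos:
  assumes secure: "secure_partition (complete_digraph UNIV) w \<mu> K L"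
    and p: "awalk_in UNIV u p v" "u \<in> L" "set (tl (nodes u p)) \<subseteq> K"
  shows "walk_weight w p \<le> 0"
proof (cases "K = {}")
  case True
  with p(3) have "p = []"
    by (cases p) (auto simp: pre_digraph.awalk_verts_conv)
  then show ?thesis by simp
next
  case False
  moreover have "L \<noteq> {}" using p(2) by blast
  ultimately have "\<forall>u\<in>L. \<forall>p v. awalk_in UNIV u p v \<and> set (tl (nodes u p)) \<subseteq> K \<longrightarrow> walk_weight w p \<le> 0"
    using secure by (simp add: secure_partition_def)
  with p show ?thesis by blast
qed

text \<open>For the shifted matrix, \<open>arc_ge\<close> expresses that the entries of the original
  matrix are nonnegative.\<close>

context
  fixes w :: "('v \<times> 'v) weight_fun" and \<mu> :: real and K L :: "'v set"
  assumes arc_ge: "\<And>e. - \<mu> \<le> w e"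
    and secure: "secure_partition (complete_digraph UNIV) w \<mu> K L"
begin

lemma secure_partition_walk_le:
  assumes p: "awalk_in K u p v"
  shows "walk_weight w p \<le> \<mu>"
proof (cases "L = {}")
  case True
  then show ?thesis
    using secure awalk_in_mono[OF p] by (auto simp: secure_partition_def bounded_secure_def)
next
  case False
  then obtain l where l: "l \<in> L" by blast
  have "awalk_in UNIV l ((l, u) # p) v"
    using awalk_in_mono[OF p] by (simp add: complete.awalk_Cons_iff)
  moreover have "set (tl (nodes l ((l, u) # p))) \<subseteq> K"
    using p by (simp add: awalk_in_iff[of K])
  ultimately have "walk_weight w ((l, u) # p) \<le> 0"
    using secure_partition_leave_nonpos[OF secure] l by blast
  then show ?thesis using arc_ge[of "(l, u)"] by simp
qed

lemma secure_partition_closed_nonpos: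
  assumes "awalk_in K k p k"
  shows "walk_weight w p \<le> 0"
  using closed_awalk_nonpos[OF assms] secure_partition_walk_le by blast

end

lemma secure_partition_move_iff:
  fixes w :: "('v \<times> 'v) weight_fun"
  assumes arc_ge: "\<And>e. - \<mu> \<le> w e"
    and secure: "secure_partition (complete_digraph UNIV) w \<mu> K L"
    and k: "k \<in> K"
  shows "secure_partition (complete_digraph UNIV) w \<mu> (K - {k}) (L \<union> {k}) \<longleftrightarrow>
         secure_node (complete_digraph K) w k"
proof
  assume secure': "secure_partition (complete_digraph UNIV) w \<mu> (K - {k}) (L \<union> {k})"
  have "walk_weight w p \<le> 0" if p: "awalk_in K k p v" for p v
  proof -
    obtain q r where qr: "p = q @ r" "awalk_in K k q k" "awalk_in K k r v"
      "set (tl (nodes k r)) \<subseteq> K - {k}"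
      using awalk_in_split_last[OF p, of "{k}"] by blast
    \<comment> \<open>The part \<open>r\<close> leaves \<open>k\<close>, now on the \<open>L\<close>
      side, and never returns to it; the part \<open>q\<close> is closed.\<close>
    have "walk_weight w r \<le> 0"
      using secure_partition_leave_nonpos[OF secure' awalk_in_mono[OF qr(3) subset_UNIV]] qr(4)
      by blast
    moreover have "walk_weight w q \<le> 0"
      using secure_partition_closed_nonpos[OF arc_ge secure] qr by blast
    ultimately show ?thesis using qr(1) by simp
  qed
  with k show "secure_node (complete_digraph K) w k"
    by (auto simp: secure_node_def)
next
  assume node: "secure_node (complete_digraph K) w k"
  have "walk_weight w p \<le> 0"
    if "u \<in> L \<union> {k}" and p: "awalk_in UNIV u p v" and sub: "set (tl (nodes u p)) \<subseteq> K - {k}" for u p v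
  \<comment> \<open>A walk starting in \<open>k\<close> lies entirely in \<open>K\<close>, where
    \<open>k\<close> is secure; one starting in \<open>L\<close> is covered by the old
    partition.\<close>
  proof (cases "u = k")
    case True
    with k sub p have "awalk_in K k p v" by (auto intro: awalk_in_of_tl_nodes)
    with node show ?thesis by (auto simp: secure_node_def)
  next
    case False
    with that show ?thesis
      using secure_partition_leave_nonpos[OF secure, of u p v] by blast
  qed
  moreover have "(K - {k}) \<union> (L \<union> {k}) = UNIV" "(K - {k}) \<inter> (L \<union> {k}) = {}"
    using secure k by (auto simp: secure_partition_def)
  ultimately show "secure_partition (complete_digraph UNIV) w \<mu> (K - {k}) (L \<union> {k})"
    unfolding secure_partition_def by auto
qed

lemma secure_partition_ex_secure_node:
  fixes w :: "('v \<times> 'v) weight_fun"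
  assumes arc_ge: "\<And>e. - \<mu> \<le> w e"
    and secure1: "secure_partition (complete_digraph UNIV) w \<mu> K\<^sub>1 L\<^sub>1"
    and secure2: "secure_partition (complete_digraph UNIV) w \<mu> K\<^sub>2 L\<^sub>2"
    and D: "finite (K\<^sub>1 - K\<^sub>2)" "K\<^sub>1 - K\<^sub>2 \<noteq> {}"
  shows "\<exists>k\<in>K\<^sub>1 - K\<^sub>2. secure_node (complete_digraph K\<^sub>1) w k"
proof (rule ccontr)
  assume none: "\<not> ?thesis"
  \<comment> \<open>Concatenation makes \<open>pos\<close> transitive, and nonpositive closed walks
    make it irreflexive. No such relation on a finite nonempty set gives every element a successor
    in the set.\<close>
  define pos where "pos k d \<longleftrightarrow> (\<exists>q. awalk_in K\<^sub>1 k q d \<and> 0 < walk_weight w q)" for k d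
  have "\<exists>d\<in>K\<^sub>1 - K\<^sub>2. pos k d" if k: "k \<in> K\<^sub>1 - K\<^sub>2" for k
  proof -
    from none k have "\<exists>p v. awalk_in K\<^sub>1 k p v \<and> 0 < walk_weight w p"
      by (auto simp: secure_node_def not_le)
    then obtain p v where p: "awalk_in K\<^sub>1 k p v" "0 < walk_weight w p" by blast
    then obtain q r d where qr: "p = q @ r" "d \<in> K\<^sub>1 - K\<^sub>2" "awalk_in K\<^sub>1 k q d"
      "awalk_in K\<^sub>1 d r v" "set (tl (nodes d r)) \<subseteq> K\<^sub>1 - (K\<^sub>1 - K\<^sub>2)"
      using awalk_in_split_last k by metis
    \<comment> \<open>After its last visit to \<open>K\<^sub>1 - K\<^sub>2\<close> at
      \<open>d\<close>, the walk stays in the intersection of \<open>K\<^sub>1\<close> and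
      \<open>K\<^sub>2\<close>, so the second partition bounds \<open>r\<close> and the positive
      weight must come from \<open>q\<close>.\<close>
    have "d \<in> L\<^sub>2" using secure2 qr(2) by (auto simp: secure_partition_def)
    moreover have "set (tl (nodes d r)) \<subseteq> K\<^sub>2" using qr(5) by blast
    ultimately have "walk_weight w r \<le> 0"
      using secure_partition_leave_nonpos[OF secure2 awalk_in_mono[OF qr(4) subset_UNIV]] by blast
    with p qr show ?thesis unfolding pos_def by force
  qed
  moreover have "\<not> pos k k" for k
    using secure_partition_closed_nonpos[OF arc_ge secure1] by (force simp: pos_def not_less)
  moreover have "pos x z" if "pos x y" "pos y z" for x y z
  proof -
    from that obtain q r where "awalk_in K\<^sub>1 x q y" "0 < walk_weight w q"
      "awalk_in K\<^sub>1 y r z" "0 < walk_weight w r"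
      by (auto simp: pos_def)
    then show ?thesis
      using complete.awalk_appendI unfolding pos_def by (metis complete.awalk_cost_append add_pos_pos)
  qed
  ultimately show False
    using finite_transitivity_chain[OF D(1), of pos] D(2) by blast
qed

theorem theorem17:
  fixes A :: "real ^ 'n ^ 'n" and \<mu> :: real and K1 L1 K2 L2 :: "'n set"
  assumes "\<forall>i j. A $ i $ j \<in> {0..1}"
    and "0 < \<mu>" and "\<mu> < 1"
    and "secure_partition (complete_digraph UNIV) (entry_weight (shifted A \<mu>)) \<mu> K1 L1"
    and "secure_partition (complete_digraph UNIV) (entry_weight (shifted A \<mu>)) \<mu> K2 L2"
    and "(K1, L1) \<noteq> (K2, L2)"
    and "L1 \<subseteq> L2"
  shows "(L2 - L1 = K1 - K2 \<and>
         (\<exists>k \<in> L2 - L1. secure_node (complete_digraph K1) (entry_weight (shifted A \<mu>)) k)) \<and>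
         (\<forall>k \<in> K1.
           secure_partition (complete_digraph UNIV) (entry_weight (shifted A \<mu>)) \<mu>
             (K1 - {k}) (L1 \<union> {k}) \<longleftrightarrow>
           secure_node (complete_digraph K1) (entry_weight (shifted A \<mu>)) k)"
proof -
  let ?w = "entry_weight (shifted A \<mu>)"
  have arc_ge: "- \<mu> \<le> ?w e" for e
    using assms(1) by (cases e) (simp add: entry_weight_def shifted_def)
  have K: "K1 = - L1" "K2 = - L2"
    using assms(4,5) by (auto simp: secure_partition_def)
  \<comment> \<open>Each partition is determined by its second set, so distinctness makes the
    inclusion of \<open>L1\<close> in \<open>L2\<close> proper.\<close>
  then have D: "L2 - L1 = K1 - K2" "K1 - K2 \<noteq> {}"
    using assms(6,7) by auto
  have "\<exists>k\<in>K1 - K2. secure_node (complete_digraph K1) ?w k"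
    using secure_partition_ex_secure_node[OF arc_ge assms(4,5) _ D(2)] by simp
  with D(1) show ?thesis
    using secure_partition_move_iff[OF arc_ge assms(4)] by simp
qed

end
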